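(* Let $p\geq 1$ be a real number and for each integer $n\ge 1$ let $K_n^{p*}=\{(x_1,\dots,x_n)\in\mathbb{R}^n: x_i\geq 0 \text{ for } i=1,\dots,n,\ x_1^p+x_2^p+\cdots+x_n^p\leq 1\}$. Then $$\lim_{n\to\infty}\gamma_{2^n}(K_n^{p*})\leq \left(\frac{1}{1+c_1}\right)^{\frac1p},$$ where $c_1=0.2938\cdots$ is the solution of $\frac{(1+c)^{1+c}}{c^c}=2$.
   Context: For a convex body $K\subset\mathbb{R}^n$ (a compact convex set with non-empty interior) and a positive integer $m$, Hadwiger's covering functional is $$\gamma_m(K)=\min\Big\{\lambda>0:\ \exists\, u_1,\dots,u_m\in\mathbb{R}^n \text{ such that } K\subseteq \bigcup_{i=1}^m(\lambda K+u_i)\Big\},$$ i.e. the smallest $\lambda$ such that $K$ can be covered by $m$ translates of $\lambda K$. *)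

theory Defs
  imports "HOL-Analysis.Analysis"
begin

text \<open>
  Since the dimension \<open>n\<close> varies inside the statement, the space of real \<open>n\<close>-vectors is rendered
  as \<^term>\<open>topspace (Euclidean_space n)\<close>: functions on the naturals that vanish from index
  \<open>n\<close> on. Coordinates are thus numbered from \<open>0\<close> to \<open>n - 1\<close>.
\<close>

definition homothet :: "real \<Rightarrow> (nat \<Rightarrow> real) set \<Rightarrow> (nat \<Rightarrow> real) \<Rightarrow> (nat \<Rightarrow> real) set" where
  "homothet l K u = (\<lambda>x j. l * x j + u j) ` K"

definition coverable :: "nat \<Rightarrow> nat \<Rightarrow> (nat \<Rightarrow> real) set \<Rightarrow> real \<Rightarrow> bool" where
  "coverable n m K l \<longleftrightarrow>
     (\<exists>u. (\<forall>i<m. u i \<in> topspace (Euclidean_space n)) \<and> K \<subseteq> (\<Union>i<m. homothet l K (u i)))"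

definition hadwiger_covering :: "nat \<Rightarrow> nat \<Rightarrow> (nat \<Rightarrow> real) set \<Rightarrow> real" where
  "hadwiger_covering n m K = Inf {l. 0 < l \<and> coverable n m K l}"

definition corner_lp_ball :: "real \<Rightarrow> nat \<Rightarrow> (nat \<Rightarrow> real) set" where
  "corner_lp_ball p n =
     {x \<in> topspace (Euclidean_space n). (\<forall>i<n. 0 \<le> x i) \<and> (\<Sum>i<n. x i powr p) \<le> 1}"

definition c1 :: real where
  "c1 = (THE c. 0 < c \<and> (1 + c) powr (1 + c) / c powr c = 2)"

text \<open>
  For a convex body in dimension at least one, the infimum in
  \<^term>\<open>hadwiger_covering n m K\<close> is attained, so it is the minimum. Only compactness
  and infinity of \<open>K\<close> are needed; infinity excludes the value \<open>0\<close>.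
\<close>

lemma homothet_1: "homothet 1 K (\<lambda>_. 0) = K"
  by (simp add: homothet_def)

lemma compact_fun_space:
  fixes C :: "('b::topological_space) set"
  assumes "compact C"
  shows "compact {u :: 'a \<Rightarrow> 'b. \<forall>i. u i \<in> C}"
proof -
  have "compactin (product_topology (\<lambda>_::'a. euclidean) UNIV) (PiE UNIV (\<lambda>_. C))"
    using assms by (subst compactin_PiE) auto
  moreover have "PiE UNIV (\<lambda>_::'a. C) = {u. \<forall>i. u i \<in> C}"
    by auto
  ultimately show ?thesis
    by (simp add: euclidean_product_topology)
qed

theorem hadwiger_covering_is_min:
  assumes "compact K" "infinite K" "K \<subseteq> topspace (Euclidean_space n)" "0 < m"
  shows "0 < hadwiger_covering n m K" "coverable n m K (hadwiger_covering n m K)"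
    and "\<And>l. 0 < l \<Longrightarrow> coverable n m K l \<Longrightarrow> hadwiger_covering n m K \<le> l"
proof -
  let ?E = "topspace (Euclidean_space n)"
  define C where "C = insert (\<lambda>_. 0) ((\<lambda>(l, x, y). \<lambda>j. x j - l * y j) ` ({0..1::real} \<times> K \<times> K))"
  have coord: "continuous_on S (\<lambda>q. f q j)" if "continuous_on S f"
    for S :: "'q::topological_space set" and f :: "'q \<Rightarrow> 'r \<Rightarrow> 's::topological_space" and j
    using that by (rule continuous_on_product_then_coordinatewise)
  have "continuous_on ({0..1::real} \<times> K \<times> K) (\<lambda>(l, x, y). \<lambda>j. x j - l * y j)"
    unfolding case_prod_unfold
    by (rule continuous_on_coordinatewise_then_product)
       (intro continuous_on_diff continuous_on_mult coord[of _ "\<lambda>p. fst (snd p)"]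
          coord[of _ "\<lambda>p. snd (snd p)"] continuous_on_fst continuous_on_snd continuous_on_id)
  then have "compact C"
    unfolding C_def
    by (intro compact_insert compact_continuous_image compact_Times assms compact_Icc)
  have CE: "C \<subseteq> ?E"
  proof
    fix z assume "z \<in> C"
    then consider "z = (\<lambda>_. 0)" | q where "q \<in> {0..1} \<times> K \<times> K"
      "z = (\<lambda>(l, x, y). \<lambda>j. x j - l * y j) q"
      unfolding C_def by (elim insertE imageE)
    then show "z \<in> ?E"
    proof cases
      case 1
      then show ?thesis by (simp add: topspace_Euclidean_space)
    next
      case (2 q)
      then have "fst (snd q) \<in> ?E" "snd (snd q) \<in> ?E"
        using assms(3) by (cases q; simp add: subset_iff)+
      with 2 show ?thesis
        by (cases q) (simp add: topspace_Euclidean_space)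
    qed
  qed
  define U where "U = {u :: nat \<Rightarrow> nat \<Rightarrow> real. \<forall>i. u i \<in> C}"
  have "compact U"
    unfolding U_def by (rule compact_fun_space) fact
  define T where "T = {(l, u). l \<in> {0..1} \<and> u \<in> U \<and> K \<subseteq> (\<Union>i<m. homothet l K (u i))}"
  define P where "P = (\<lambda>x i. fst ` (({0..1} \<times> U) \<times> K \<inter>
      {q. (\<lambda>j. fst (fst q) * snd q j + snd (fst q) i j) = x}))"
  have contP: "continuous_on UNIV
      (\<lambda>q :: (real \<times> (nat \<Rightarrow> nat \<Rightarrow> real)) \<times> (nat \<Rightarrow> real). \<lambda>j. fst (fst q) * snd q j + snd (fst q) i j)"
    for i
    by (rule continuous_on_coordinatewise_then_product)
       (intro continuous_on_add continuous_on_mult coord[of _ snd] coord[of _ "\<lambda>q. snd (fst q) i"]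
          coord[of _ "\<lambda>q. snd (fst q)"] continuous_on_fst continuous_on_snd continuous_on_id)
  have "compact (P x i)" for x i
    unfolding P_def
    by (intro compact_continuous_image compact_Int_closed compact_Times \<open>compact U\<close> assms
          closed_Collect_eq contP continuous_on_const continuous_on_fst continuous_on_id compact_Icc)
  then have clP: "closed (\<Union>i<m. P x i)" for x
    by (intro closed_UN compact_imp_closed) auto
  have "T = ({0..1} \<times> U) \<inter> (\<Inter>x\<in>K. \<Union>i<m. P x i)"
  proof -
    have iff: "x \<in> homothet l K (u i) \<longleftrightarrow> (l, u) \<in> P x i" if "l \<in> {0..1}" "u \<in> U" for x l u i
      unfolding P_def homothet_def using that by (force simp only: image_iff fst_conv snd_conv
          mem_Times_iff Int_iff mem_Collect_eq prod.exhaust_sel bex_simps)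
    show ?thesis
    proof (rule set_eqI)
      fix q :: "real \<times> (nat \<Rightarrow> nat \<Rightarrow> real)"
      obtain l u where q: "q = (l, u)" by (cases q)
      show "q \<in> T \<longleftrightarrow> q \<in> ({0..1} \<times> U) \<inter> (\<Inter>x\<in>K. \<Union>i<m. P x i)"
        unfolding q T_def subset_iff using iff[of l u] by auto
    qed
  qed
  then have "compact T"
    using clP by (simp only:) (intro compact_Int_closed compact_Times \<open>compact U\<close> closed_INT ballI
        compact_Icc)
  have "(1, \<lambda>_ _. 0) \<in> T"
    using assms(4) by (auto simp: T_def U_def C_def homothet_1)
  then obtain t where t: "t \<in> T" "\<And>s. s \<in> T \<Longrightarrow> fst t \<le> fst s"
    using continuous_attains_inf[OF \<open>compact T\<close> _ continuous_on_fst[OF continuous_on_id]]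
    by blast
  define l0 where "l0 = fst t"
  have l01: "0 \<le> l0" "l0 \<le> 1"
    using t(1) by (auto simp: T_def l0_def)
  have cov: "K \<subseteq> (\<Union>i<m. homothet l0 K (snd t i))" and "snd t \<in> U"
    using t(1) by (simp_all add: T_def l0_def case_prod_unfold)
  have "l0 \<noteq> 0"
  proof
    assume "l0 = 0"
    then have "K \<subseteq> snd t ` {..<m}"
      using cov by (auto simp: homothet_def)
    then show False
      using assms(2) finite_subset by blast
  qed
  then have pos: "0 < l0"
    using l01 by simp
  have cov0: "coverable n m K l0"
    unfolding coverable_def using cov \<open>snd t \<in> U\<close> CE by (auto simp: U_def)
  have le: "l0 \<le> l" if l: "0 < l" "coverable n m K l" for l
  proof (cases "l \<le> 1")
    case True
    obtain u where u: "K \<subseteq> (\<Union>i<m. homothet l K (u i))"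
      using l(2) by (auto simp: coverable_def)
    define v where "v i = (if K \<inter> homothet l K (u i) = {} then (\<lambda>_. 0) else u i)" for i
    have "v i \<in> C" for i
    proof (cases "K \<inter> homothet l K (u i) = {}")
      case False
      then obtain x y where xy: "x \<in> K" "y \<in> K" "x = (\<lambda>j. l * y j + u i j)"
        by (auto simp: homothet_def)
      then have "u i = (\<lambda>(l, x, y). \<lambda>j. x j - l * y j) (l, x, y)"
        by auto
      moreover have "(l, x, y) \<in> {0..1} \<times> K \<times> K"
        using xy l True by auto
      ultimately show ?thesis
        using False unfolding C_def v_def if_not_P[OF False] by (intro insertI2 image_eqI)
    qed (simp add: v_def C_def)
    moreover have "K \<subseteq> (\<Union>i<m. homothet l K (v i))"
    proof
      fix x assume "x \<in> K"
      then obtain i where "i < m" "x \<in> homothet l K (u i)"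
        using u by auto
      moreover from this have "v i = u i"
        using \<open>x \<in> K\<close> by (auto simp: v_def)
      ultimately show "x \<in> (\<Union>i<m. homothet l K (v i))"
        by (metis UN_I lessThan_iff)
    qed
    ultimately have "(l, v) \<in> T"
      using l True by (auto simp: T_def U_def)
    then show ?thesis
      using t(2) by (auto simp: l0_def)
  qed (use l01 in simp)
  have eq: "hadwiger_covering n m K = l0"
    unfolding hadwiger_covering_def
    by (rule cInf_eq_minimum) (use pos cov0 le in auto)
  show "0 < hadwiger_covering n m K" "coverable n m K (hadwiger_covering n m K)"
    "\<And>l. 0 < l \<Longrightarrow> coverable n m K l \<Longrightarrow> hadwiger_covering n m K \<le> l"
    using pos cov0 le by (simp_all add: eq)
qed

lemma c1_unique: "\<exists>!c::real. 0 < c \<and> (1 + c) powr (1 + c) / c powr c = 2"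
proof -
  define g :: "real \<Rightarrow> real" where "g c = (1 + c) * ln (1 + c) - c * ln c" for c
  have eq: "(1 + c) powr (1 + c) / c powr c = exp (g c)" if "0 < c" for c
    using that by (simp add: powr_def g_def exp_diff)
  have iff: "(1 + c) powr (1 + c) / c powr c = 2 \<longleftrightarrow> g c = ln 2" if "0 < c" for c
    using eq[OF that] by (metis exp_ln ln_exp zero_less_numeral)
  have der: "(g has_real_derivative (ln (1 + c) - ln c)) (at c)" if "0 < c" for c
    unfolding g_def using that by (auto intro!: derivative_eq_intros)
  have mono: "g a < g b" if "0 < a" "a < b" for a b
  proof (rule DERIV_pos_imp_increasing[OF that(2)])
    fix x assume "a \<le> x" "x \<le> b"
    then show "\<exists>y. (g has_real_derivative y) (at x) \<and> 0 < y"
      using that by (intro exI[of _ "ln (1 + x) - ln x"] conjI der) auto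
  qed
  have "g (1/8) \<le> ln 2"
  proof -
    have "(9/8::real) ^ 9 * 8 \<le> 2 ^ 8" by (simp add: field_simps)
    then have "ln ((9/8::real) ^ 9 * 8) \<le> ln (2 ^ 8)" by (subst ln_le_cancel_iff) auto
    moreover have "ln ((9/8::real) ^ 9 * 8) = 9 * ln (9/8) + ln 8"
      by (subst ln_mult_pos) (auto simp: ln_realpow)
    moreover have "ln ((2::real) ^ 8) = 8 * ln 2"
      by (subst ln_realpow) auto
    ultimately have "9 * ln (9/8::real) + ln 8 \<le> 8 * ln 2" by linarith
    then show ?thesis by (simp add: g_def ln_div field_simps)
  qed
  moreover have "ln 2 \<le> g 1"
    by (simp add: g_def)
  moreover have "continuous_on {1/8..1} g"
    by (intro continuous_at_imp_continuous_on ballI DERIV_isCont[OF der]) auto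
  ultimately obtain c where c: "1/8 \<le> c" "g c = ln 2"
    using IVT'[of g "1/8" "ln 2" 1] by auto
  show ?thesis
  proof (rule ex1I[of _ c])
    show "0 < c \<and> (1 + c) powr (1 + c) / c powr c = 2"
      using c iff[of c] by auto
    fix d :: real
    assume "0 < d \<and> (1 + d) powr (1 + d) / d powr d = 2"
    then show "d = c"
      using c iff[of d] mono[of c d] mono[of d c] by (cases c d rule: linorder_cases) auto
  qed
qed

end

theory Submission
  imports Defs
begin

text \<open>
  In the coordinates \<open>y i = x i powr p\<close> the body is the simplex, and since \<open>t powr p\<close> is
  superadditive, translating \<open>x\<close> by \<open>u\<close> lowers the mass \<open>\<Sum>x i powr p\<close> at least by
  \<open>\<Sum>u i powr p\<close>. Rounding \<open>y\<close> down to a lattice of mesh \<open>1 / (n + k)\<close>, with the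
  coordinate sum cut off at \<open>k\<close> steps, leaves mass at most \<open>n / (n + k)\<close>; for
  \<open>k \<le> c1 * n\<close> a generating function bound shows that at most \<open>2 ^ n\<close> lattice points
  occur. This gives the upper bound.

  For the existence of the limit, a cover in dimension \<open>n\<close> is used in every block of \<open>n\<close>
  coordinates of a much larger dimension \<open>D\<close>, scaled by the rounded mass of the block. The
  extra factor caused by the rounding is compensated by leaving a small proportion of the
  blocks, those of least mass, untouched. So the value in dimension \<open>D\<close> exceeds the one in
  dimension \<open>n\<close> by at most \<open>\<epsilon>\<close> once \<open>n\<close> and then \<open>D\<close> are large, which forces convergence.
\<close>

section \<open>Covers of the corner ball and the covering functional\<close>

text \<open>The parameter \<open>r\<close> is the \<open>p\<close>-th power of the homothety ratio.\<close>
definition lp_cover :: "real \<Rightarrow> nat \<Rightarrow> nat \<Rightarrow> real \<Rightarrow> bool" where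
  "lp_cover p n m r \<longleftrightarrow>
     (\<exists>U :: (nat \<Rightarrow> real) set. finite U \<and> card U \<le> m \<and>
       (\<forall>x. (\<forall>j<n. 0 \<le> x j) \<longrightarrow> (\<Sum>j<n. x j powr p) \<le> 1 \<longrightarrow>
         (\<exists>u\<in>U. (\<forall>j<n. u j \<le> x j) \<and> (\<Sum>j<n. (x j - u j) powr p) \<le> r)))"

text \<open>A point of lower dimension is padded with zeros; cutting back to the first
  \<open>n'\<close> coordinates only drops nonnegative summands. This later absorbs dimensions that
  are not multiples of the block length.\<close>

lemma lp_cover_mono:
  assumes "lp_cover p n m r" "n' \<le> n" "m \<le> m'" "r \<le> r'"
  shows "lp_cover p n' m' r'"
proof -
  obtain U :: "(nat \<Rightarrow> real) set" where U: "finite U" "card U \<le> m"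
    and cov: "\<And>x. (\<forall>j<n. 0 \<le> x j) \<Longrightarrow> (\<Sum>j<n. x j powr p) \<le> 1 \<Longrightarrow>
         (\<exists>u\<in>U. (\<forall>j<n. u j \<le> x j) \<and> (\<Sum>j<n. (x j - u j) powr p) \<le> r)"
    using assms(1) unfolding lp_cover_def by blast
  have "\<exists>u\<in>U. (\<forall>j<n'. u j \<le> x j) \<and> (\<Sum>j<n'. (x j - u j) powr p) \<le> r'"
    if x: "\<forall>j<n'. 0 \<le> x j" "(\<Sum>j<n'. x j powr p) \<le> 1" for x :: "nat \<Rightarrow> real"
  proof -
    define y where "y j = (if j < n' then x j else 0)" for j
    have "(\<Sum>j<n. y j powr p) = (\<Sum>j<n'. x j powr p)"
      using assms(2) by (intro sum.mono_neutral_cong_right) (auto simp: y_def)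
    moreover have "\<forall>j<n. 0 \<le> y j"
      using x by (simp add: y_def)
    ultimately obtain u where u: "u \<in> U" "\<forall>j<n. u j \<le> y j" "(\<Sum>j<n. (y j - u j) powr p) \<le> r"
      using cov[of y] x(2) by metis
    have "(\<Sum>j<n'. (x j - u j) powr p) = (\<Sum>j<n'. (y j - u j) powr p)"
      by (intro sum.cong) (auto simp: y_def)
    also have "\<dots> \<le> (\<Sum>j<n. (y j - u j) powr p)"
      using assms(2) by (intro sum_mono2) auto
    finally have "(\<Sum>j<n'. (x j - u j) powr p) \<le> r'"
      using u(3) assms(4) by linarith
    moreover have "\<forall>j<n'. u j \<le> x j"
      using u(2) assms(2) by (auto simp: y_def split: if_splits)
    ultimately show ?thesis using u(1) by blast
  qed
  then show ?thesis
    unfolding lp_cover_def using U assms(3) by (intro exI[of _ U]) auto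
qed

text \<open>On the first \<open>n\<close> coordinates, \<open>x - u = l * y\<close> with
  \<open>y\<close> in the body means that \<open>x - u\<close> is nonnegative with mass at most
  \<open>l powr p\<close>, since mass is homogeneous of degree \<open>p\<close>. The converse
  divides by \<open>l\<close>.\<close>

lemma lp_cover_if_coverable:
  assumes "0 < l" and "coverable n m (corner_lp_ball p n) l"
  shows "lp_cover p n m (l powr p)"
proof -
  obtain u where u: "corner_lp_ball p n \<subseteq> (\<Union>i<m. homothet l (corner_lp_ball p n) (u i))"
    using assms(2) by (auto simp: coverable_def)
  have "\<exists>v\<in>u ` {..<m}. (\<forall>j<n. v j \<le> x j) \<and> (\<Sum>j<n. (x j - v j) powr p) \<le> l powr p"
    if x: "\<forall>j<n. 0 \<le> x j" "(\<Sum>j<n. x j powr p) \<le> 1" for x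
  proof -
    \<comment> \<open>\<open>lp_cover\<close> leaves values from index \<open>n\<close> on free,
      while points of the body vanish there.\<close>
    have "(\<lambda>j. if j < n then x j else 0) \<in> corner_lp_ball p n"
      using x by (auto simp: corner_lp_ball_def topspace_Euclidean_space)
    then obtain i where i: "i < m" "(\<lambda>j. if j < n then x j else 0) \<in> homothet l (corner_lp_ball p n) (u i)"
      using u by blast
    then obtain y where y: "y \<in> corner_lp_ball p n"
      "(\<lambda>j. if j < n then x j else 0) = (\<lambda>j. l * y j + u i j)"
      by (auto simp: homothet_def)
    have eq: "x j - u i j = l * y j" if "j < n" for j
      using fun_cong[OF y(2), of j] that by simp
    have "(\<Sum>j<n. (x j - u i j) powr p) = l powr p * (\<Sum>j<n. y j powr p)"
      by (simp add: eq powr_mult sum_distrib_left)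
    also have "\<dots> \<le> l powr p * 1"
      using y(1) by (intro mult_left_mono) (auto simp: corner_lp_ball_def)
    finally have "(\<Sum>j<n. (x j - u i j) powr p) \<le> l powr p" by simp
    moreover have "u i j \<le> x j" if "j < n" for j
    proof -
      have "0 \<le> l * y j"
        using y(1) that assms(1) by (auto simp: corner_lp_ball_def)
      then show ?thesis using eq[OF that] by simp
    qed
    ultimately show ?thesis using i(1) by blast
  qed
  moreover have "card (u ` {..<m}) \<le> m"
    using card_image_le[of "{..<m}" u] by simp
  ultimately show ?thesis
    unfolding lp_cover_def by (intro exI[of _ "u ` {..<m}"]) auto
qed

lemma coverable_if_lp_cover:
  assumes "0 < l" and "lp_cover p n m (l powr p)"
  shows "coverable n m (corner_lp_ball p n) l"
proof -
  obtain U :: "(nat \<Rightarrow> real) set" where U: "finite U" "card U \<le> m"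
    and cov: "\<And>x. (\<forall>j<n. 0 \<le> x j) \<Longrightarrow> (\<Sum>j<n. x j powr p) \<le> 1 \<Longrightarrow>
         (\<exists>u\<in>U. (\<forall>j<n. u j \<le> x j) \<and> (\<Sum>j<n. (x j - u j) powr p) \<le> l powr p)"
    using assms(2) unfolding lp_cover_def by blast
  obtain h where h: "bij_betw h {0..<card U} U"
    using ex_bij_betw_nat_finite[OF U(1)] by blast
  define u where "u i j = (if j < n then h i j else 0)" for i j
  have "corner_lp_ball p n \<subseteq> (\<Union>i<m. homothet l (corner_lp_ball p n) (u i))"
  proof
    fix x assume x: "x \<in> corner_lp_ball p n"
    then obtain v where v: "v \<in> U" "\<forall>j<n. v j \<le> x j" "(\<Sum>j<n. (x j - v j) powr p) \<le> l powr p"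
      using cov[of x] by (auto simp: corner_lp_ball_def)
    obtain i where i: "i < card U" "v = h i"
      using v(1) h by (force simp: bij_betw_def)
    define y where "y j = (if j < n then (x j - v j) / l else 0)" for j
    have "(\<Sum>j<n. y j powr p) = (\<Sum>j<n. (x j - v j) powr p) / l powr p"
      by (simp add: y_def powr_divide sum_divide_distrib)
    then have "y \<in> corner_lp_ball p n"
      using v assms(1) by (auto simp: corner_lp_ball_def topspace_Euclidean_space y_def)
    moreover have "x = (\<lambda>j. l * y j + u i j)"
      using x assms(1) i by (auto simp: y_def u_def corner_lp_ball_def topspace_Euclidean_space)
    ultimately have "x \<in> homothet l (corner_lp_ball p n) (u i)"
      unfolding homothet_def by blast
    then show "x \<in> (\<Union>i<m. homothet l (corner_lp_ball p n) (u i))"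
      using i U(2) by (intro UN_I[of i]) auto
  qed
  then show ?thesis
    unfolding coverable_def by (intro exI[of _ u]) (auto simp: u_def topspace_Euclidean_space)
qed

lemma coverable_1: "0 < m \<Longrightarrow> coverable n m K 1"
  unfolding coverable_def
  by (intro exI[of _ "\<lambda>_ _. 0"]) (auto simp: homothet_1 topspace_Euclidean_space)

lemma hadwiger_covering_nonneg:
  assumes "0 < m"
  shows "0 \<le> hadwiger_covering n m K"
proof -
  \<comment> \<open>The infimum of the empty set is unspecified; the ratio 1 is always
    feasible.\<close>
  have "{l. 0 < l \<and> coverable n m K l} \<noteq> {}"
    using coverable_1[OF assms] zero_less_one by blast
  then show ?thesis
    unfolding hadwiger_covering_def by (intro cInf_greatest) auto
qed

lemma hadwiger_covering_le:
  assumes "0 < l" "coverable n m K l"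
  shows "hadwiger_covering n m K \<le> l"
  unfolding hadwiger_covering_def
  using assms by (intro cInf_lower bdd_belowI[of _ 0]) auto

lemma hadwiger_powr_le:
  assumes "1 \<le> p" "0 < m" "0 < r" "lp_cover p n m r"
  shows "hadwiger_covering n m (corner_lp_ball p n) powr p \<le> r"
proof -
  have "(r powr (1 / p)) powr p = r"
    using assms by (simp add: powr_powr)
  then have "hadwiger_covering n m (corner_lp_ball p n) \<le> r powr (1 / p)"
    using assms by (intro hadwiger_covering_le coverable_if_lp_cover) auto
  then have "hadwiger_covering n m (corner_lp_ball p n) powr p \<le> (r powr (1 / p)) powr p"
    using assms by (intro powr_mono2 hadwiger_covering_nonneg) auto
  then show ?thesis
    using assms by (simp add: powr_powr)
qed

text \<open>The strict inequality yields a feasible ratio below \<open>r powr (1 / p)\<close>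
  straight from the infimum.\<close>

lemma lp_cover_above_hadwiger:
  assumes "1 \<le> p" "0 < m" "hadwiger_covering n m (corner_lp_ball p n) powr p < r"
  shows "lp_cover p n m r"
proof -
  let ?G = "hadwiger_covering n m (corner_lp_ball p n)"
  have "0 < r"
    using assms(3) by (meson powr_ge_zero le_less_trans)
  have "(?G powr p) powr (1 / p) < r powr (1 / p)"
    using assms by (intro powr_less_mono2) auto
  then have "?G < r powr (1 / p)"
    using assms hadwiger_covering_nonneg[of m n "corner_lp_ball p n"] by (simp add: powr_powr)
  moreover have "{l. 0 < l \<and> coverable n m (corner_lp_ball p n) l} \<noteq> {}"
    using coverable_1[OF assms(2)] zero_less_one by blast
  ultimately have "\<exists>l\<in>{l. 0 < l \<and> coverable n m (corner_lp_ball p n) l}. l < r powr (1 / p)"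
    unfolding hadwiger_covering_def by (metis cInf_lessD)
  then obtain l where l: "0 < l" "coverable n m (corner_lp_ball p n) l" "l < r powr (1 / p)"
    by blast
  have "l powr p \<le> (r powr (1 / p)) powr p"
    using l assms by (intro powr_mono2) auto
  also have "\<dots> = r"
    using assms \<open>0 < r\<close> by (simp add: powr_powr)
  finally show ?thesis
    using lp_cover_if_coverable[OF l(1,2)] by (blast intro: lp_cover_mono)
qed

section \<open>Lattice rounding and counting of lattice points\<close>

text \<open>Division by \<open>a + b\<close> reduces this to \<open>t powr p \<le> t\<close> on the
  unit interval, for two fractions with sum 1.\<close>

lemma powr_add_le_powr_sum:
  fixes a b p :: real
  assumes "1 \<le> p" "0 \<le> a" "0 \<le> b"
  shows "a powr p + b powr p \<le> (a + b) powr p"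
proof (cases "a = 0 \<or> b = 0")
  case False
  then have pos: "0 < a" "0 < b" using assms by auto
  have "(a / (a + b)) powr p \<le> a / (a + b)" "(b / (a + b)) powr p \<le> b / (a + b)"
    using assms pos by (auto intro!: powr_le_one_le)
  then have "(a / (a + b)) powr p + (b / (a + b)) powr p \<le> a / (a + b) + b / (a + b)"
    by linarith
  also have "\<dots> = 1"
    using pos by (simp flip: add_divide_distrib)
  finally show ?thesis
    using pos by (simp add: powr_divide pos_divide_le_eq flip: add_divide_distrib)
qed auto

text \<open>The rounded points in units of the mesh. As extensional functions with values capped by
  \<open>k\<close> they lie in a finite product, over which sums of products factor.\<close>

definition bounded_vectors :: "nat \<Rightarrow> nat \<Rightarrow> (nat \<Rightarrow> nat) set" where
  "bounded_vectors n k = {a \<in> {..<n} \<rightarrow>\<^sub>E {..k}. (\<Sum>i<n. a i) \<le> k}"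

lemma finite_bounded_vectors: "finite (bounded_vectors n k)"
proof -
  have "finite ({..<n} \<rightarrow>\<^sub>E {..k})"
    by (intro finite_PiE) auto
  then show ?thesis
    unfolding bounded_vectors_def by simp
qed

lemma restrict_in_bounded_vectors:
  assumes "(\<Sum>i<n. a i) \<le> k"
  shows "restrict a {..<n} \<in> bounded_vectors n k"
proof -
  have "a i \<le> k" if "i < n" for i
    using member_le_sum[of i "{..<n}" a] that assms by simp
  then show ?thesis
    using assms by (auto simp: bounded_vectors_def)
qed

text \<open>
  Each counted vector \<open>a\<close> has weight \<open>(\<Prod>i<n. x ^ a i) \<ge> x ^ k\<close>, and the weights of all
  vectors of length \<open>n\<close> add up to a product of \<open>n\<close> geometric series.
\<close>
lemma card_bounded_vectors:
  fixes x :: real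
  assumes "0 < x" "x < 1"
  shows "card (bounded_vectors n k) * x ^ k * (1 - x) ^ n \<le> 1"
proof -
  have "card (bounded_vectors n k) * x ^ k = (\<Sum>a\<in>bounded_vectors n k. x ^ k)"
    by simp
  also have "\<dots> \<le> (\<Sum>a\<in>bounded_vectors n k. \<Prod>i<n. x ^ a i)"
  proof (rule sum_mono)
    fix a assume "a \<in> bounded_vectors n k"
    then have "x ^ k \<le> x ^ (\<Sum>i<n. a i)"
      using assms by (intro power_decreasing) (auto simp: bounded_vectors_def)
    then show "x ^ k \<le> (\<Prod>i<n. x ^ a i)"
      by (simp add: power_sum)
  qed
  also have "\<dots> \<le> (\<Sum>a\<in>{..<n} \<rightarrow>\<^sub>E {..k}. \<Prod>i<n. x ^ a i)"
    using assms
    by (intro sum_mono2 finite_PiE prod_nonneg) (auto simp: bounded_vectors_def)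
  also have "\<dots> = (\<Prod>i<n. \<Sum>j\<le>k. x ^ j)"
    by (subst prod_sum_PiE) auto
  also have "\<dots> = (\<Sum>j\<le>k. x ^ j) ^ n"
    by simp
  finally have "card (bounded_vectors n k) * x ^ k * (1 - x) ^ n \<le> (\<Sum>j\<le>k. x ^ j) ^ n * (1 - x) ^ n"
    using assms by (intro mult_right_mono) auto
  also have "\<dots> = ((1 - x) * (\<Sum>j\<le>k. x ^ j)) ^ n"
    by (simp add: power_mult_distrib mult.commute)
  also have "\<dots> = (1 - x ^ Suc k) ^ n"
    by (subst sum_gp0) (use assms in auto)
  also have "\<dots> \<le> 1"
    using assms by (intro power_le_one) (auto simp: power_le_one mult_le_one)
  finally show ?thesis .
qed

text \<open>Greedy choice: the last coordinate takes \<open>min k (f n)\<close> and the earlier ones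
  supply the rest.\<close>

lemma sum_dominated_eq:
  fixes f :: "nat \<Rightarrow> nat"
  assumes "k \<le> (\<Sum>i<n. f i)"
  obtains a where "\<And>i. i < n \<Longrightarrow> a i \<le> f i" "(\<Sum>i<n. a i) = k"
proof -
  from assms have "\<exists>a. (\<forall>i<n. a i \<le> f i) \<and> (\<Sum>i<n. a i) = k"
  proof (induction n arbitrary: k)
    case (Suc n)
    then obtain a where a: "\<forall>i<n. a i \<le> f i" "(\<Sum>i<n. a i) = k - min k (f n)"
      by (atomize_elim, intro Suc.IH) auto
    show ?case
      using a by (intro exI[of _ "a(n := min k (f n))"]) (auto simp: less_Suc_eq)
  qed auto
  then show thesis using that by blast
qed

text \<open>If the rounded sum is at most \<open>k\<close>, each coordinate loses at most one mesh
  \<open>1 / N\<close>, in total \<open>n / N\<close>. Otherwise exactly \<open>k\<close> steps are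
  subtracted, leaving at most \<open>1 - k / N\<close>. The choice \<open>N = n + k\<close> makes
  the two bounds equal.\<close>

lemma lp_cover_lattice:
  assumes "1 \<le> p" "0 < n"
  shows "lp_cover p n (card (bounded_vectors n k)) (n / (n + k))"
proof -
  define N where "N = real (n + k)"
  have N: "0 < N" using assms by (simp add: N_def)
  define v where "v a i = (real (a i) / N) powr (1 / p)" for a :: "nat \<Rightarrow> nat" and i
  have "\<exists>u\<in>v ` bounded_vectors n k.
      (\<forall>j<n. u j \<le> x j) \<and> (\<Sum>j<n. (x j - u j) powr p) \<le> n / (n + k)"
    if x: "\<forall>j<n. 0 \<le> x j" "(\<Sum>j<n. x j powr p) \<le> 1" for x
  proof -
    define f where "f i = nat \<lfloor>N * x i powr p\<rfloor>" for i
    have f: "real (f i) \<le> N * x i powr p" "N * x i powr p \<le> real (f i) + 1" for i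
      using N by (simp_all add: f_def)
    obtain a where a: "\<forall>i<n. a i \<le> f i" "(\<Sum>i<n. a i) \<le> k"
      "(\<Sum>j<n. x j powr p - a j / N) \<le> n / N"
    proof (cases "(\<Sum>i<n. f i) \<le> k")
      case True
      have "x j powr p - f j / N \<le> 1 / N" for j
        using divide_right_mono[OF f(2)[of j], of N] N by (simp add: add_divide_distrib)
      then have "(\<Sum>j<n. x j powr p - f j / N) \<le> (\<Sum>j<n. 1 / N)"
        by (intro sum_mono) auto
      then show ?thesis using that[of f] True by simp
    next
      case False
      then obtain a where a: "\<And>i. i < n \<Longrightarrow> a i \<le> f i" "(\<Sum>i<n. a i) = k"
        using sum_dominated_eq[of k f n] by auto
      have "(\<Sum>j<n. x j powr p - a j / N) = (\<Sum>j<n. x j powr p) - real (\<Sum>j<n. a j) / N"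
        by (simp add: sum_subtractf sum_divide_distrib)
      also have "\<dots> \<le> 1 - real k / N"
        using x a by simp
      also have "\<dots> = n / N"
        using N by (subst eq_divide_eq) (simp add: left_diff_distrib, simp add: N_def)
      finally show ?thesis using that[of a] a by simp
    qed
    have le: "real (a j) / N \<le> x j powr p" if "j < n" for j
    proof -
      have "real (a j) \<le> real (f j)"
        using a(1) that by simp
      then have "real (a j) \<le> N * x j powr p"
        using f(1)[of j] by linarith
      then show ?thesis
        using N by (simp add: pos_divide_le_eq mult.commute)
    qed
    have vp: "v a j powr p = a j / N" for j
      using N assms by (simp add: v_def powr_powr)
    have vx: "v a j \<le> x j" if "j < n" for j
    proof -
      have "v a j \<le> (x j powr p) powr (1 / p)"
        unfolding v_def using le[OF that] N assms by (intro powr_mono2) auto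
      then show ?thesis using assms x that by (simp add: powr_powr)
    qed
    have v0: "0 \<le> v a j" for j
      by (simp add: v_def)
    have "(x j - v a j) powr p \<le> x j powr p - a j / N" if "j < n" for j
      using powr_add_le_powr_sum[of p "x j - v a j" "v a j"] vx[OF that] v0[of j] assms(1)
      by (simp add: vp)
    then have "(\<Sum>j<n. (x j - v a j) powr p) \<le> (\<Sum>j<n. x j powr p - a j / N)"
      by (intro sum_mono) auto
    then have "(\<Sum>j<n. (x j - v a j) powr p) \<le> n / N"
      using a(3) by linarith
    then show ?thesis
      using vx restrict_in_bounded_vectors[OF a(2)]
      by (intro bexI[of _ "v (restrict a {..<n})"]) (auto simp: v_def N_def)
  qed
  moreover have "card (v ` bounded_vectors n k) \<le> card (bounded_vectors n k)"
    by (rule card_image_le[OF finite_bounded_vectors])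
  ultimately show ?thesis
    unfolding lp_cover_def using finite_bounded_vectors
    by (intro exI[of _ "v ` bounded_vectors n k"]) auto
qed

section \<open>Block covers in large dimension\<close>

text \<open>Removing an element of greatest value does not raise the average; this is repeated until
  \<open>d\<close> elements remain.\<close>

lemma light_subset:
  fixes f :: "'a \<Rightarrow> real"
  assumes "finite A" "d \<le> card A"
  obtains J where "J \<subseteq> A" "card J = d" "card A * sum f J \<le> d * sum f A"
proof -
  from assms have "\<exists>J. J \<subseteq> A \<and> card J = d \<and> card A * sum f J \<le> d * sum f A"
  proof (induction "card A - d" arbitrary: A)
    case 0
    then show ?case by (intro exI[of _ A]) auto
  next
    case (Suc e)
    then have "A \<noteq> {}" by auto
    then obtain z where z: "z \<in> A" "Max (f ` A) = f z"
      using obtains_MAX[OF Suc.prems(1)] by blast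
    have z_max: "f y \<le> f z" if "y \<in> A" for y
      using Max_ge[of "f ` A" "f y"] Suc.prems(1) that by (simp add: z(2))
    have c: "card A = Suc (card (A - {z}))"
      by (rule card.remove[OF Suc.prems(1) z(1)])
    have e: "e = card (A - {z}) - d" "d \<le> card (A - {z})"
      using Suc.hyps(2) c by linarith+
    obtain J where J: "J \<subseteq> A - {z}" "card J = d"
      "card (A - {z}) * sum f J \<le> d * sum f (A - {z})"
      using Suc.hyps(1)[OF e(1) finite_Diff[OF Suc.prems(1)] e(2)] by (elim exE conjE)
    have "sum f J \<le> (\<Sum>j\<in>J. f z)"
      using J(1) by (intro sum_mono z_max) blast
    then have "sum f J \<le> d * f z"
      by (simp add: J(2))
    moreover have "sum f A = f z + sum f (A - {z})"
      by (rule sum.remove[OF Suc.prems(1) z(1)])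
    then have "d * sum f A = d * f z + d * sum f (A - {z})"
      by (simp only: distrib_left)
    moreover have "card A * sum f J = sum f J + card (A - {z}) * sum f J"
      unfolding c by (simp only: of_nat_Suc distrib_right mult_1_left)
    ultimately have "card A * sum f J \<le> d * sum f A"
      using J(3) by linarith
    then show ?case using J(1,2) by blast
  qed
  then show thesis using that by blast
qed

text \<open>Division by \<open>t powr (1 / p)\<close> turns mass \<open>t\<close> into mass 1, and
  scaling back multiplies the remaining mass by \<open>t\<close>. The set \<open>U\<close> is fixed
  in the hypothesis so that all blocks and all scales share it.\<close>

lemma lp_cover_scaled:
  assumes "1 \<le> p" "0 < t"
    and cov: "\<And>x :: nat \<Rightarrow> real. (\<forall>j<n. 0 \<le> x j) \<Longrightarrow> (\<Sum>j<n. x j powr p) \<le> 1 \<Longrightarrow>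
         (\<exists>u\<in>U. (\<forall>j<n. u j \<le> x j) \<and> (\<Sum>j<n. (x j - u j) powr p) \<le> r)"
    and x: "\<And>j. j < n \<Longrightarrow> 0 \<le> x j" "(\<Sum>j<n. x j powr p) \<le> t"
  shows "\<exists>u\<in>U. (\<forall>j<n. t powr (1 / p) * u j \<le> x j) \<and>
    (\<Sum>j<n. (x j - t powr (1 / p) * u j) powr p) \<le> r * t"
proof -
  define s where "s = t powr (1 / p)"
  have s: "0 < s" "s powr p = t"
    using assms by (simp_all add: s_def powr_powr)
  have "(\<Sum>j<n. (x j / s) powr p) = (\<Sum>j<n. x j powr p) / t"
    by (simp add: powr_divide s sum_divide_distrib)
  also have "\<dots> \<le> 1"
    using x assms(2) by simp
  finally obtain u where u: "u \<in> U" "\<forall>j<n. u j \<le> x j / s" "(\<Sum>j<n. (x j / s - u j) powr p) \<le> r"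
    using cov[of "\<lambda>j. x j / s"] x(1) s(1) by auto
  have "x j - s * u j = s * (x j / s - u j)" for j
    using s by (simp add: field_simps)
  then have "(\<Sum>j<n. (x j - s * u j) powr p) = t * (\<Sum>j<n. (x j / s - u j) powr p)"
    by (simp add: powr_mult s sum_distrib_left)
  also have "\<dots> \<le> t * r"
    using u assms(2) by (intro mult_left_mono) auto
  finally have "(\<Sum>j<n. (x j - s * u j) powr p) \<le> r * t"
    by (simp add: mult.commute)
  moreover have "\<forall>j<n. s * u j \<le> x j"
    using u(2) s(1) by (simp add: pos_le_divide_eq mult.commute)
  ultimately show ?thesis
    using u(1) unfolding s_def by blast
qed

lemma sum_lessThan_mult: "(\<Sum>i<q * n. f i) = (\<Sum>b<q. \<Sum>j<n. f (b * n + j))"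
  for f :: "nat \<Rightarrow> 'a::comm_monoid_add"
proof -
  have "(\<Sum>i\<in>{b * n..<b * n + n}. f i) = (\<Sum>j<n. f (b * n + j))" for b
    using sum.shift_bounds_nat_ivl[of f 0 "b * n" n]
    by (simp add: atLeast0LessThan add.commute)
  then show ?thesis
    by (simp add: sum.nat_group[symmetric])
qed

text \<open>
  A point is split into \<open>q\<close> blocks of length \<open>n\<close>, whose masses sum to at most 1. The \<open>d\<close>
  lightest blocks are not translated at all, which costs mass at most \<open>d / q\<close> but saves
  a factor \<open>T ^ d\<close> in the number of translates. The masses of the others are rounded up
  to multiples of \<open>1 / (R * q)\<close>, recorded in \<open>a\<close>, and the rescaled cover of dimension \<open>n\<close>
  is used in each block.
\<close>
lemma lp_cover_blocks:
  assumes p: "1 \<le> p" and "0 < n" "0 < q" "0 < R" "d \<le> q" "0 \<le> r" and cov: "lp_cover p n T r"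
  shows "lp_cover p (q * n) (card (bounded_vectors q ((R + 1) * q)) * T ^ (q - d))
           (r + r / R + d / q)"
proof -
  obtain U :: "(nat \<Rightarrow> real) set" where U: "finite U" "card U \<le> T"
    and covU: "\<And>x. (\<forall>j<n. 0 \<le> x j) \<Longrightarrow> (\<Sum>j<n. x j powr p) \<le> 1 \<Longrightarrow>
         (\<exists>u\<in>U. (\<forall>j<n. u j \<le> x j) \<and> (\<Sum>j<n. (x j - u j) powr p) \<le> r)"
    using cov unfolding lp_cover_def by blast
  \<comment> \<open>Covering the origin forces \<open>1 \<le> T\<close>, so powers of
    \<open>T\<close> grow with the exponent.\<close>
  have "U \<noteq> {}"
    using covU[of "\<lambda>_. 0"] by auto
  then have "0 < card U"
    using U by auto
  then have "1 \<le> T"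
    using U by linarith
  define M where "M = R * q"
  have M: "0 < M" using assms by (simp add: M_def)
  define supp where "supp a = {b. b < q \<and> a b \<noteq> 0}" for a :: "nat \<Rightarrow> nat"
  have fin_supp: "finite (supp a)" for a by (simp add: supp_def)
  \<comment> \<open>The total mass is at most \<open>M = R * q\<close> units, and rounding up adds
    at most one unit for each of the \<open>q\<close> blocks.\<close>
  define C where "C = {a \<in> bounded_vectors q ((R + 1) * q). card (supp a) \<le> q - d}"
  have C: "finite C" "card C \<le> card (bounded_vectors q ((R + 1) * q))"
    unfolding C_def using finite_bounded_vectors by (auto intro: card_mono)
  \<comment> \<open>Coordinate \<open>i\<close> is place \<open>i mod n\<close> of block
    \<open>i div n\<close>; \<open>f\<close> picks a vector of \<open>U\<close> for each block in
    \<open>supp a\<close>, and the other blocks stay in place.\<close>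
  define w where "w a f i = (if a (i div n) = 0 then 0
      else (a (i div n) / M) powr (1 / p) * f (i div n) (i mod n))"
    for a :: "nat \<Rightarrow> nat" and f :: "nat \<Rightarrow> nat \<Rightarrow> real" and i
  define W where "W = (\<Union>a\<in>C. w a ` (supp a \<rightarrow>\<^sub>E U))"
  have finPi: "finite (supp a \<rightarrow>\<^sub>E U)" for a
    using U fin_supp by (intro finite_PiE) auto
  have "card (w a ` (supp a \<rightarrow>\<^sub>E U)) \<le> T ^ (q - d)" if "a \<in> C" for a
  proof -
    have "card (w a ` (supp a \<rightarrow>\<^sub>E U)) \<le> card (supp a \<rightarrow>\<^sub>E U)"
      using finPi by (rule card_image_le)
    also have "\<dots> = card U ^ card (supp a)"
      by (simp add: card_PiE fin_supp)
    also have "\<dots> \<le> T ^ card (supp a)"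
      using U by (intro power_mono) auto
    also have "\<dots> \<le> T ^ (q - d)"
      using that \<open>1 \<le> T\<close> by (intro power_increasing) (auto simp: C_def)
    finally show ?thesis .
  qed
  then have "(\<Sum>a\<in>C. card (w a ` (supp a \<rightarrow>\<^sub>E U))) \<le> card C * T ^ (q - d)"
    using sum_bounded_above[of C "\<lambda>a. card (w a ` (supp a \<rightarrow>\<^sub>E U))" "T ^ (q - d)"] by simp
  moreover have "card W \<le> (\<Sum>a\<in>C. card (w a ` (supp a \<rightarrow>\<^sub>E U)))"
    unfolding W_def by (rule card_UN_le[OF C(1)])
  ultimately have "card W \<le> card (bounded_vectors q ((R + 1) * q)) * T ^ (q - d)"
    using mult_le_mono1[OF C(2), of "T ^ (q - d)"] by linarith
  moreover have "finite W"
    unfolding W_def using C finPi by auto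
  moreover have "\<exists>u\<in>W. (\<forall>i<q * n. u i \<le> x i) \<and> (\<Sum>i<q * n. (x i - u i) powr p) \<le> r + r / R + d / q"
    if x: "\<forall>i<q * n. 0 \<le> x i" "(\<Sum>i<q * n. x i powr p) \<le> 1" for x
  proof -
    have idx: "b * n + j < q * n" if "b < q" "j < n" for b j
    proof -
      have "b * n + j < Suc b * n" using that by simp
      also have "\<dots> \<le> q * n" using that by (intro mult_le_mono1) simp
      finally show ?thesis .
    qed
    define s where "s b = (\<Sum>j<n. x (b * n + j) powr p)" for b
    have s0: "0 \<le> s b" for b by (simp add: s_def sum_nonneg)
    have s1: "(\<Sum>b<q. s b) \<le> 1"
      using x(2) by (simp add: s_def sum_lessThan_mult)
    obtain J where J: "J \<subseteq> {..<q}" "card J = d" "q * sum s J \<le> d * (\<Sum>b<q. s b)"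
      using light_subset[of "{..<q}" d s] assms by auto
    have "real q * sum s J \<le> real d"
      using J(3) mult_left_mono[OF s1, of "real d"] by simp
    then have sJ: "sum s J \<le> d / q"
      using assms by (simp add: pos_le_divide_eq mult.commute)
    \<comment> \<open>The value 0 marks a light block as untranslated. Elsewhere the ceiling ensures
      \<open>s b \<le> a b / M\<close>, so the cover scaled to mass \<open>a b / M\<close>
      applies.\<close>
    define a where "a = restrict (\<lambda>b. if b \<in> J then 0 else nat \<lceil>M * s b\<rceil>) {..<q}"
    have a_bounds: "a b \<le> M * s b + 1" "b \<notin> J \<Longrightarrow> M * s b \<le> a b" if "b < q" for b
      using that s0[of b] M by (auto simp: a_def)
    have "real (\<Sum>b<q. a b) \<le> (\<Sum>b<q. M * s b + 1)"
      unfolding of_nat_sum using a_bounds(1) by (intro sum_mono) auto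
    also have "\<dots> = M * (\<Sum>b<q. s b) + q"
      by (simp add: sum.distrib sum_distrib_left)
    also have "\<dots> \<le> M + real q"
      using mult_left_mono[OF s1, of "real M"] by simp
    also have "\<dots> = real ((R + 1) * q)"
      by (simp add: M_def algebra_simps)
    finally have sum_a: "(\<Sum>b<q. a b) \<le> (R + 1) * q"
      by (simp only: of_nat_le_iff)
    have "a \<in> bounded_vectors q ((R + 1) * q)"
      using restrict_in_bounded_vectors[OF sum_a] by (simp only: a_def restrict_restrict Int_absorb)
    moreover have "card (supp a) \<le> q - d"
    proof -
      have "supp a \<subseteq> {..<q} - J" by (auto simp: supp_def a_def)
      then have "card (supp a) \<le> card ({..<q} - J)" by (intro card_mono) auto
      also have "\<dots> = q - d"
        using J by (subst card_Diff_subset) (auto intro: finite_subset)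
      finally show ?thesis .
    qed
    ultimately have "a \<in> C" by (simp add: C_def)
    define good where "good b v \<longleftrightarrow> v \<in> U \<and>
        (\<forall>j<n. (a b / M) powr (1 / p) * v j \<le> x (b * n + j)) \<and>
        (\<Sum>j<n. (x (b * n + j) - (a b / M) powr (1 / p) * v j) powr p) \<le> r * (a b / M)" for b v
    have "\<exists>v. good b v" if "b \<in> supp a" for b
    proof -
      have b: "b < q" "a b \<noteq> 0" using that by (auto simp: supp_def)
      then have "b \<notin> J" by (auto simp: a_def)
      have "s b \<le> a b / M"
        using a_bounds(2)[OF b(1) \<open>b \<notin> J\<close>] M by (simp add: pos_le_divide_eq mult.commute)
      then have sx: "(\<Sum>j<n. x (b * n + j) powr p) \<le> a b / M"
        by (simp add: s_def)
      have t0: "0 < a b / M" and x0: "\<And>j. j < n \<Longrightarrow> 0 \<le> x (b * n + j)"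
        using b M x(1) idx by simp_all
      show ?thesis
        unfolding good_def
        using lp_cover_scaled[where x = "\<lambda>j. x (b * n + j)", OF p t0 covU x0 sx]
        by (simp only: Bex_def)
    qed
    then obtain f0 where "\<And>b. b \<in> supp a \<Longrightarrow> good b (f0 b)"
      by metis
    then have f0: "\<And>b. b \<in> supp a \<Longrightarrow> f0 b \<in> U"
      "\<And>b j. b \<in> supp a \<Longrightarrow> j < n \<Longrightarrow> (a b / M) powr (1 / p) * f0 b j \<le> x (b * n + j)"
      "\<And>b. b \<in> supp a \<Longrightarrow>
        (\<Sum>j<n. (x (b * n + j) - (a b / M) powr (1 / p) * f0 b j) powr p) \<le> r * (a b / M)"
      unfolding good_def by simp_all
    define u where "u = w a (restrict f0 (supp a))"
    have "u \<in> W"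
      unfolding u_def W_def using f0(1) \<open>a \<in> C\<close> by (intro UN_I[of a] imageI) auto
    have u: "u (b * n + j) = (if a b = 0 then 0 else (a b / M) powr (1 / p) * f0 b j)"
      if "b < q" "j < n" for b j
      using that by (auto simp: u_def w_def supp_def)
    have u_le: "u i \<le> x i" if "i < q * n" for i
    proof -
      have "i div n < q" "i mod n < n"
        using that assms by (simp_all add: less_mult_imp_div_less)
      then show ?thesis
        using u[of "i div n" "i mod n"] f0(2)[of "i div n" "i mod n"] x(1) that
        by (auto simp: supp_def)
    qed
    have block: "(\<Sum>j<n. (x (b * n + j) - u (b * n + j)) powr p)
        \<le> (if b \<in> J then s b else 0) + r * (a b / M)" if b: "b < q" for b
    proof (cases "a b = 0")
      case True
      \<comment> \<open>Since masses are rounded up, a block outside \<open>J\<close> with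
        \<open>a b = 0\<close> has no mass, so leaving it in place costs nothing.\<close>
      then have "b \<notin> J \<Longrightarrow> s b = 0"
        using a_bounds(2)[OF b] s0[of b] M by (auto simp: mult_le_0_iff)
      moreover have "(\<Sum>j<n. (x (b * n + j) - u (b * n + j)) powr p) = s b"
        using True b by (simp add: s_def u)
      ultimately show ?thesis using True by auto
    next
      case False
      then have "b \<in> supp a" "b \<notin> J" using b by (auto simp: supp_def a_def)
      then show ?thesis using f0(3)[of b] u[OF b] False by simp
    qed
    have "(\<Sum>i<q * n. (x i - u i) powr p) = (\<Sum>b<q. \<Sum>j<n. (x (b * n + j) - u (b * n + j)) powr p)"
      by (rule sum_lessThan_mult)
    also have "\<dots> \<le> (\<Sum>b<q. (if b \<in> J then s b else 0) + r * (a b / M))"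
      using block by (intro sum_mono) auto
    also have "\<dots> = (\<Sum>b<q. if b \<in> J then s b else 0) + r / M * real (\<Sum>b<q. a b)"
      by (simp add: sum.distrib sum_distrib_left sum_divide_distrib)
    also have "(\<Sum>b<q. if b \<in> J then s b else 0) = sum s J"
      using J(1) by (subst sum.inter_restrict[symmetric]) (auto simp: Int_absorb1)
    also have "r / M * real (\<Sum>b<q. a b) \<le> r / M * real ((R + 1) * q)"
      using sum_a assms(6) by (intro mult_left_mono of_nat_mono) auto
    also have "\<dots> = r + r / R"
      using assms by (simp add: M_def field_simps)
    finally have "(\<Sum>i<q * n. (x i - u i) powr p) \<le> r + r / R + d / q"
      using sJ by linarith
    then show ?thesis
      using \<open>u \<in> W\<close> u_le by blast
  qed
  ultimately show ?thesis
    unfolding lp_cover_def by (intro exI[of _ W]) auto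
qed

section \<open>The constant \<open>c1\<close>\<close>

text \<open>Exponential growth rate in \<open>n\<close> of the binomial coefficient
  \<open>(n + k) choose k\<close> for \<open>k\<close> about \<open>c * n\<close>, which counts
  \<open>bounded_vectors n k\<close>.\<close>

definition growth :: "real \<Rightarrow> real" where
  "growth c = (1 + c) powr (1 + c) / c powr c"

text \<open>The logarithm has derivative \<open>ln (1 + c) - ln c > 0\<close>. Monotonicity lets
  values of \<open>growth\<close> at rational points bracket \<open>c1\<close>.\<close>

lemma growth_strict_mono:
  assumes "0 < a" "a < b"
  shows "growth a < growth b"
proof -
  define g :: "real \<Rightarrow> real" where "g c = (1 + c) * ln (1 + c) - c * ln c" for c
  have eq: "growth c = exp (g c)" if "0 < c" for c
    using that by (simp add: growth_def powr_def g_def exp_diff)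
  have der: "(g has_real_derivative (ln (1 + c) - ln c)) (at c)" if "0 < c" for c
    unfolding g_def using that by (auto intro!: derivative_eq_intros)
  have "g a < g b"
  proof (rule DERIV_pos_imp_increasing[OF assms(2)])
    fix x assume "a \<le> x" "x \<le> b"
    then show "\<exists>y. (g has_real_derivative y) (at x) \<and> 0 < y"
      using assms by (intro exI[of _ "ln (1 + x) - ln x"] conjI der) auto
  qed
  then show ?thesis using eq assms by simp
qed

lemma growth_c1: "0 < c1" "growth c1 = 2"
  using theI'[OF c1_unique] unfolding c1_def[symmetric] growth_def by auto

text \<open>
  Writing \<open>ln 0.2938 = ln 1.1752 - 2 * ln 2\<close> makes all arguments exceed 1, as
  \<open>ln_approx_bounds\<close> requires.
\<close>
lemma c1_bounds: "0.2938 \<le> c1" "c1 < 0.2939"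
proof -
  have eq: "ln (growth c) = (1 + c) * ln (1 + c) - c * ln c" if "0 < c" for c
    using that by (simp add: growth_def ln_div)
  have ln2: "693145/1000000 \<le> ln (2::real)" "ln (2::real) \<le> 69315/100000"
    using ln_approx_bounds[of 2 5] by (simp_all add: eval_nat_numeral)
  have "ln (12938/10000::real) \<le> 257585/1000000"
    using ln_approx_bounds[of "12938/10000" 3] by (simp add: eval_nat_numeral)
  moreover have "161437/1000000 \<le> ln (11752/10000::real)"
    using ln_approx_bounds[of "11752/10000" 3] by (simp add: eval_nat_numeral)
  moreover have "ln (2938/10000::real) = ln (11752/10000) - 2 * ln 2"
    using ln_div[of "11752/10000" "2\<^sup>2::real"] ln_realpow[of 2 2] by simp
  then have "ln (growth (2938/10000)) =
      12938/10000 * ln (12938/10000) - 2938/10000 * ln (11752/10000) + 5876/10000 * ln 2"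
    using eq[of "2938/10000"] by (simp add: algebra_simps)
  ultimately have "ln (growth (2938/10000)) \<le> ln 2"
    using ln2 by linarith
  then have "growth (2938/10000) \<le> 2"
    by (subst (asm) ln_le_cancel_iff) (auto simp: growth_def)
  then show "0.2938 \<le> c1"
    using growth_strict_mono[of c1 "2938/10000"] growth_c1 by force
  have "25766/100000 \<le> ln (12939/10000::real)"
    using ln_approx_bounds[of "12939/10000" 3] by (simp add: eval_nat_numeral)
  moreover have "ln (11756/10000::real) \<le> 16178/100000"
    using ln_approx_bounds[of "11756/10000" 3] by (simp add: eval_nat_numeral)
  moreover have "ln (2939/10000::real) = ln (11756/10000) - 2 * ln 2"
    using ln_div[of "11756/10000" "2\<^sup>2::real"] ln_realpow[of 2 2] by simp
  then have "ln (growth (2939/10000)) =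
      12939/10000 * ln (12939/10000) - 2939/10000 * ln (11756/10000) + 5878/10000 * ln 2"
    using eq[of "2939/10000"] by (simp add: algebra_simps)
  ultimately have "ln 2 < ln (growth (2939/10000))"
    using ln2 by linarith
  then have "2 < growth (2939/10000)"
    by (subst (asm) ln_less_cancel_iff) (auto simp: growth_def)
  then show "c1 < 0.2939"
    using growth_strict_mono[of "2939/10000" c1] growth_c1
    by (cases "c1 = 2939/10000") force+
qed

section \<open>The upper bound in a fixed dimension\<close>

text \<open>The weight \<open>x = c1 / (1 + c1)\<close> maximises
  \<open>x powr c1 * (1 - x)\<close>, and the maximum is \<open>1 / growth c1 = 1 / 2\<close>; the
  generating function bound then gives \<open>2 ^ n\<close>.\<close>

lemma card_bounded_vectors_c1:
  assumes "real k \<le> c1 * n"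
  shows "card (bounded_vectors n k) \<le> 2 ^ n"
proof -
  note c = growth_c1(1)
  define x where "x = c1 / (1 + c1)"
  have x: "0 < x" "x < 1" and x': "1 - x = 1 / (1 + c1)"
    using c by (simp_all add: x_def field_simps)
  have "x powr c1 / (1 + c1) = c1 powr c1 / (1 + c1) powr (1 + c1)"
    using c by (simp add: x_def powr_divide powr_add field_simps)
  also have "\<dots> = 1 / growth c1"
    by (simp add: growth_def)
  finally have half: "x powr c1 * (1 - x) = 1 / 2"
    using x by (simp add: growth_c1 x')
  have "(1 / 2) ^ n = (x powr c1) ^ n * (1 - x) ^ n"
    by (simp only: half[symmetric] power_mult_distrib)
  also have "(x powr c1) ^ n = x powr (c1 * n)"
    using x by (simp add: powr_powr powr_realpow[symmetric])
  also have "\<dots> \<le> x powr k"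
    using assms x by (intro powr_mono') auto
  also have "x powr k = x ^ k"
    using x by (simp add: powr_realpow)
  finally have "(1 / 2) ^ n \<le> x ^ k * (1 - x) ^ n"
    using x by (simp add: mult_right_mono)
  then have "card (bounded_vectors n k) * (1 / 2) ^ n \<le> card (bounded_vectors n k) * (x ^ k * (1 - x) ^ n)"
    by (intro mult_left_mono) auto
  also have "\<dots> \<le> 1"
    using card_bounded_vectors[OF x, of n k] by (simp add: mult.assoc)
  finally have "real (card (bounded_vectors n k)) \<le> 2 ^ n"
    by (simp add: power_divide pos_divide_le_eq)
  then have "real (card (bounded_vectors n k)) \<le> real (2 ^ n)"
    by simp
  then show ?thesis
    by (simp only: of_nat_le_iff)
qed

lemma hadwiger_upper_bound:
  assumes "1 \<le> p" "0 < n"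
  shows "hadwiger_covering n (2 ^ n) (corner_lp_ball p n) powr p \<le> 1 / (1 + c1 - 1 / n)"
proof -
  \<comment> \<open>The largest \<open>k\<close> that the count permits; the floor lowers
    \<open>k / n\<close> by at most \<open>1 / n\<close>.\<close>
  define k where "k = nat \<lfloor>c1 * n\<rfloor>"
  have k: "real k \<le> c1 * n" "c1 * n \<le> real k + 1"
    using growth_c1(1) by (simp_all add: k_def)
  have "lp_cover p n (2 ^ n) (n / (n + k))"
    using lp_cover_mono[OF lp_cover_lattice[OF assms, of k] order_refl
        card_bounded_vectors_c1[OF k(1)] order_refl] by simp
  then have "hadwiger_covering n (2 ^ n) (corner_lp_ball p n) powr p \<le> n / (n + k)"
    by (intro hadwiger_powr_le) (use assms in auto)
  also have "\<dots> = 1 / (1 + k / n)"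
    using assms by (simp add: field_simps)
  also have "\<dots> \<le> 1 / (1 + c1 - 1 / n)"
  proof (intro divide_left_mono)
    have "c1 - 1 / n \<le> k / n"
      using divide_right_mono[OF k(2), of "real n"] assms by (simp add: add_divide_distrib)
    then show "1 + c1 - 1 / n \<le> 1 + k / n" by simp
    have "1 / real n \<le> 1" using assms by simp
    then have "0 < 1 + c1 - 1 / n" using growth_c1(1) by linarith
    then show "0 < (1 + k / n) * (1 + c1 - 1 / n)"
      using growth_c1(1) assms by (intro mult_pos_pos add_pos_nonneg) auto
  qed auto
  finally show ?thesis .
qed

section \<open>Transfer between dimensions and existence of the limit\<close>

text \<open>
  With \<open>d\<close> proportional to \<open>q * (R + 2) / n\<close>, the factor \<open>2 ^ (n * d)\<close> saved in
  \<open>lp_cover_blocks\<close> pays for the rounding of the block masses.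
\<close>
lemma lp_cover_power_2_transfer:
  assumes "1 \<le> p" "0 < e" "e \<le> 1"
  obtains n0 where "\<And>n. n0 \<le> n \<Longrightarrow> \<exists>D0. \<forall>D\<ge>D0. \<forall>r. 0 \<le> r \<longrightarrow> r \<le> 2 \<longrightarrow>
    lp_cover p n (2 ^ n) r \<longrightarrow> lp_cover p D (2 ^ D) (r + e)"
proof -
  \<comment> \<open>This size gives \<open>r / R \<le> e / 2\<close> for all
    \<open>r \<le> 2\<close>.\<close>
  define R where "R = nat \<lceil>4 / e\<rceil>"
  have R: "4 / e \<le> R"
    unfolding R_def using assms by simp
  then have "0 < R" using assms by (metis divide_pos_pos of_nat_0_less_iff order_less_le_trans zero_less_numeral)
  \<comment> \<open>There are at most \<open>2 ^ (L * q)\<close> rounded mass vectors: weight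
    \<open>1/2\<close> in \<open>card_bounded_vectors\<close> gives the exponent
    \<open>(R + 1) * q + q\<close>.\<close>
  define L where "L = R + 2"
  \<comment> \<open>For \<open>n0 \<le> n\<close> one has \<open>L / n \<le> e / 4\<close>; with
    \<open>2 / q \<le> e / 4\<close>, ensured by \<open>q0\<close> below, \<open>d / q\<close> stays
    within \<open>e / 2\<close>.\<close>
  define n0 where "n0 = Suc (nat \<lceil>4 * L / e\<rceil>)"
  have "\<exists>D0. \<forall>D\<ge>D0. \<forall>r. 0 \<le> r \<longrightarrow> r \<le> 2 \<longrightarrow>
    lp_cover p n (2 ^ n) r \<longrightarrow> lp_cover p D (2 ^ D) (r + e)" if "n0 \<le> n" for n
  proof -
    have n: "0 < n" "4 * L / e \<le> n"
      using that unfolding n0_def by linarith+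
    define q0 where "q0 = nat \<lceil>8 / e\<rceil>"
    have "lp_cover p D (2 ^ D) (r + e)"
      if D: "q0 * n \<le> D" and r: "0 \<le> r" "r \<le> 2" "lp_cover p n (2 ^ n) r" for D r
    proof -
      \<comment> \<open>Enough blocks to contain \<open>D\<close> coordinates, with an overshoot of
        at most \<open>n\<close>.\<close>
      define q where "q = D div n + 1"
      have "D = D div n * n + D mod n" by simp
      moreover have "D mod n < n" using n by simp
      ultimately have q: "D \<le> q * n" "q * n \<le> D + n"
        unfolding q_def add_mult_distrib by linarith+
      have "q0 \<le> D div n"
        using D n by (simp add: less_eq_div_iff_mult_less_eq)
      then have "q0 \<le> q" by (simp add: q_def)
      then have q8: "8 / e \<le> q" "0 < q"
        unfolding q0_def using assms by (auto simp: q_def)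
      \<comment> \<open>Of the two extra blocks, one makes up for the floor and the other for the
        overshoot \<open>q * n - D \<le> n\<close>.\<close>
      define d where "d = L * q div n + 2"
      have "L * q = L * q div n * n + L * q mod n" by simp
      moreover have "L * q mod n < n" using n by simp
      ultimately have d_ge: "L * q + n \<le> d * n"
        unfolding d_def add_mult_distrib by linarith
      have "real (L * q div n) \<le> real (L * q) / n"
        by (rule of_nat_div_le_of_nat)
      then have "d / q \<le> (real L * q / n + 2) / q"
        unfolding d_def by (intro divide_right_mono) auto
      also have "\<dots> = L / n + 2 / q"
        using q8(2) by (simp add: add_divide_distrib)
      also have "\<dots> \<le> e / 4 + e / 4"
        using n q8 assms by (intro add_mono) (simp_all add: field_simps)
      finally have dq: "d / q \<le> e / 2" by simp
      then have "d / q \<le> 1" using assms by linarith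
      then have "d \<le> q" using q8(2) by simp
      have "r / R \<le> 2 / (4 / e)"
        using r R assms by (intro frac_le) auto
      then have rR: "r / R \<le> e / 2" by simp
      have "real (card (bounded_vectors q ((R + 1) * q))) * ((1/2) ^ ((R + 1) * q) * (1/2) ^ q) \<le> 1"
        using card_bounded_vectors[of "1/2" q "(R + 1) * q"] by (simp add: mult.assoc)
      also have "(1/2::real) ^ ((R + 1) * q) * (1/2) ^ q = (1/2) ^ (L * q)"
        by (simp add: L_def algebra_simps flip: power_add)
      finally have "real (card (bounded_vectors q ((R + 1) * q))) \<le> 2 ^ (L * q)"
        by (simp add: power_divide pos_divide_le_eq)
      then have "real (card (bounded_vectors q ((R + 1) * q))) \<le> real (2 ^ (L * q))"
        by simp
      then have "card (bounded_vectors q ((R + 1) * q)) \<le> 2 ^ (L * q)"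
        by (simp only: of_nat_le_iff)
      then have "card (bounded_vectors q ((R + 1) * q)) * (2 ^ n) ^ (q - d) \<le> 2 ^ (L * q) * (2 ^ n) ^ (q - d)"
        by (rule mult_le_mono1)
      also have "\<dots> = 2 ^ (L * q + n * (q - d))"
        by (simp add: power_add power_mult)
      also have "\<dots> \<le> 2 ^ D"
      proof (rule power_increasing)
        have "n * (q - d) = q * n - d * n"
          by (metis diff_mult_distrib2 mult.commute)
        moreover have "d * n \<le> q * n" using \<open>d \<le> q\<close> by simp
        ultimately show "L * q + n * (q - d) \<le> D"
          using d_ge q(2) by linarith
      qed simp
      finally have "card (bounded_vectors q ((R + 1) * q)) * (2 ^ n) ^ (q - d) \<le> 2 ^ D" .
      moreover have "r + r / R + d / q \<le> r + e"
        using dq rR by linarith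
      ultimately show ?thesis
        using lp_cover_mono[OF lp_cover_blocks[OF assms(1) n(1) q8(2) \<open>0 < R\<close> \<open>d \<le> q\<close> r(1,3)] q(1)]
        by blast
    qed
    then show ?thesis by blast
  qed
  then show thesis using that by blast
qed

text \<open>Let \<open>l\<close> be the limit of a convergent subsequence. A late member of it,
  taken as \<open>n\<close>, bounds all later values by \<open>l + e\<close>. Taking instead
  \<open>n = D\<close> and comparing with a still later member bounds \<open>h D\<close> below by
  \<open>l - e\<close>.\<close>

lemma convergent_if_eventually_almost_below:
  fixes h :: "nat \<Rightarrow> real"
  assumes bounds: "\<And>n. a \<le> h n" "\<And>n. h n \<le> b"
    and step: "\<And>e. 0 < e \<Longrightarrow> \<exists>n0. \<forall>n\<ge>n0. \<exists>D0. \<forall>D\<ge>D0. h D \<le> h n + e"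
  shows "convergent h"
proof -
  have "seq_compact {a..b}"
    by (simp add: compact_imp_seq_compact)
  then obtain l \<phi> where \<phi>: "strict_mono \<phi>" "(h \<circ> \<phi>) \<longlonglongrightarrow> l"
    using bounds by (auto elim!: seq_compactE[where f = h])
  have "h \<longlonglongrightarrow> l"
  proof (rule LIMSEQ_I)
    fix e :: real assume "0 < e"
    then obtain n0 where n0: "\<forall>n\<ge>n0. \<exists>D0. \<forall>D\<ge>D0. h D \<le> h n + e / 3"
      using step[of "e / 3"] by auto
    obtain k0 where k0: "\<forall>k\<ge>k0. norm ((h \<circ> \<phi>) k - l) < e / 3"
      using LIMSEQ_D[OF \<phi>(2), of "e / 3"] \<open>0 < e\<close> by auto
    have "n0 \<le> \<phi> (max k0 n0)"
      using seq_suble[OF \<phi>(1), of "max k0 n0"] by linarith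
    then obtain D0 where D0: "\<forall>D\<ge>D0. h D \<le> h (\<phi> (max k0 n0)) + e / 3"
      using n0 by blast
    have "norm (h D - l) < e" if D: "max n0 D0 \<le> D" for D
    proof -
      have "h D \<le> h (\<phi> (max k0 n0)) + e / 3" using D0 D by auto
      moreover have "norm ((h \<circ> \<phi>) (max k0 n0) - l) < e / 3"
        using k0 by simp
      ultimately have up: "h D < l + e"
        using \<open>0 < e\<close> unfolding real_norm_def comp_def by linarith
      obtain D1 where D1: "\<forall>D'\<ge>D1. h D' \<le> h D + e / 3"
        using n0 D by auto
      have "D1 \<le> \<phi> (max k0 D1)"
        using seq_suble[OF \<phi>(1), of "max k0 D1"] by linarith
      then have "h (\<phi> (max k0 D1)) \<le> h D + e / 3" using D1 by blast
      moreover have "norm ((h \<circ> \<phi>) (max k0 D1) - l) < e / 3"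
        using k0 by simp
      ultimately have "l < h D + e"
        using \<open>0 < e\<close> unfolding real_norm_def comp_def by linarith
      with up show ?thesis by auto
    qed
    then show "\<exists>no. \<forall>n\<ge>no. norm (h n - l) < e" by blast
  qed
  then show ?thesis by (rule convergentI)
qed

lemma hadwiger_powr_convergent:
  assumes "1 \<le> p"
  shows "convergent (\<lambda>n. hadwiger_covering n (2 ^ n) (corner_lp_ball p n) powr p)"
proof (rule convergent_if_eventually_almost_below)
  let ?h = "\<lambda>n. hadwiger_covering n (2 ^ n) (corner_lp_ball p n) powr p"
  show "0 \<le> ?h n" for n by simp
  show h1: "?h n \<le> 1" for n
    using hadwiger_covering_nonneg[of "2 ^ n" n] hadwiger_covering_le[OF zero_less_one coverable_1]
      assms by (intro powr_le1) auto
  fix \<epsilon> :: real assume "0 < \<epsilon>"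
  \<comment> \<open>One \<open>e\<close> lifts the ratio strictly above the infimum, a second is
    lost in the transfer; \<open>e \<le> 1\<close> and \<open>?h n \<le> 1\<close> keep the ratio at
    most 2.\<close>
  define e where "e = min 1 (\<epsilon> / 2)"
  have e: "0 < e" "e \<le> 1" "e \<le> \<epsilon> / 2" using \<open>0 < \<epsilon>\<close> by (auto simp: e_def)
  obtain n0 where n0: "\<And>n. n0 \<le> n \<Longrightarrow> \<exists>D0. \<forall>D\<ge>D0. \<forall>r. 0 \<le> r \<longrightarrow> r \<le> 2 \<longrightarrow>
    lp_cover p n (2 ^ n) r \<longrightarrow> lp_cover p D (2 ^ D) (r + e)"
    using lp_cover_power_2_transfer[OF assms e(1,2)] by blast
  have "\<exists>D0. \<forall>D\<ge>D0. ?h D \<le> ?h n + \<epsilon>" if n: "n0 \<le> n" for n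
  proof -
    obtain D0 where D0: "\<And>D r. D0 \<le> D \<Longrightarrow> 0 \<le> r \<Longrightarrow> r \<le> 2 \<Longrightarrow>
        lp_cover p n (2 ^ n) r \<Longrightarrow> lp_cover p D (2 ^ D) (r + e)"
      using n0[OF n] by blast
    have r: "0 \<le> ?h n + e" "?h n + e \<le> 2"
      using h1[of n] e by (auto intro: add_nonneg_nonneg)
    have "lp_cover p n (2 ^ n) (?h n + e)"
      using assms e by (intro lp_cover_above_hadwiger) auto
    then have "lp_cover p D (2 ^ D) (?h n + e + e)" if "D0 \<le> D" for D
      using D0[OF that r] by blast
    then have "?h D \<le> ?h n + e + e" if "D0 \<le> D" for D
      using that e by (intro hadwiger_powr_le add_nonneg_pos[OF r(1)]) (auto simp: assms)
    then have "?h D \<le> ?h n + \<epsilon>" if "D0 \<le> D" for D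
      using e(3) that by force
    then show ?thesis by blast
  qed
  then show "\<exists>n0. \<forall>n\<ge>n0. \<exists>D0. \<forall>D\<ge>D0. ?h D \<le> ?h n + \<epsilon>" by blast
qed

theorem theorem1p3:
  fixes p :: real
  assumes "p \<ge> 1"
  shows "0.2938 \<le> c1 \<and> c1 < 0.2939 \<and>
    (\<exists>L. (\<lambda>n. hadwiger_covering n (2 ^ n) (corner_lp_ball p n)) \<longlonglongrightarrow> L \<and>
         L \<le> (1 / (1 + c1)) powr (1 / p))"
proof -
  let ?g = "\<lambda>n. hadwiger_covering n (2 ^ n) (corner_lp_ball p n)"
  obtain l where l: "(\<lambda>n. ?g n powr p) \<longlonglongrightarrow> l"
    using hadwiger_powr_convergent[OF assms] by (auto simp: convergent_def)
  have l0: "0 \<le> l"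
    using l by (rule LIMSEQ_le_const) auto
  have "(\<lambda>n. 1 / (1 + c1 - 1 / real n)) \<longlonglongrightarrow> 1 / (1 + c1 - 0)"
    using growth_c1(1) by (intro tendsto_intros lim_1_over_n) auto
  \<comment> \<open>The upper bound requires positive dimension, hence the witness 1.\<close>
  then have "l \<le> 1 / (1 + c1 - 0)"
    using l hadwiger_upper_bound[OF assms]
    by (intro LIMSEQ_le[of _ l]) (auto intro!: exI[of _ 1])
  then have "l powr (1 / p) \<le> (1 / (1 + c1)) powr (1 / p)"
    using l0 assms by (intro powr_mono2) auto
  \<comment> \<open>Convergence is known for the \<open>p\<close>-th powers; the positive exponent
    \<open>1 / p\<close> allows passing to roots even if \<open>l = 0\<close>.\<close>
  moreover have "(\<lambda>n. (?g n powr p) powr (1 / p)) \<longlonglongrightarrow> l powr (1 / p)"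
    using assms by (intro tendsto_powr2 l tendsto_const) auto
  then have "?g \<longlonglongrightarrow> l powr (1 / p)"
    using assms hadwiger_covering_nonneg by (simp add: powr_powr)
  ultimately show ?thesis
    using c1_bounds by blast
qed

end
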